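(* Let $n\in\mathbb{Z}_+$, $0\neq L>-1/2$, $\eta\in\mathbb{R}$ and $\rho\ne0$. Then $$R_n^{(L-1)}(\eta;\rho)F_L(\eta,\rho)-\frac{L+1}{L}\,\sqrt{\frac{2L+3}{2L+1}}\,\frac{\sqrt{\eta^2+L^2}}{\sqrt{\eta^2+(L+1)^2}}\,R_{n-1}^{(L)}(\eta;\rho)F_{L-1}(\eta,\rho)=\sqrt{\frac{2L+2n+1}{2L+1}}\,F_{L+n}(\eta,\rho).$$
   Context: $\mathbb{Z}_+=\{0,1,2,\dots\}$. For real $\eta$ and index $n$ put $$w_n=\frac{\sqrt{(n+1)^2+\eta^2}}{(n+1)\sqrt{(2n+1)(2n+3)}},\qquad \lambda_n=-\frac{\eta}{n(n+1)}.$$ For real $M>-3/2$, $M\ne-1$, the polynomials $P_n^{(M)}(\eta;z)$ in $z$ are given by $P_{-1}^{(M)}=0$, $P_0^{(M)}=1$ and $$zP_n^{(M)}(\eta;z)=w_{M+n}P_{n-1}^{(M)}(\eta;z)+\lambda_{M+n+1}P_n^{(M)}(\eta;z)+w_{M+n+1}P_{n+1}^{(M)}(\eta;z),\quad n\in\mathbb{Z}_+,$$ (for $n=0$ the first term on the right is absent), and $R_n^{(M)}(\eta;\rho)=P_n^{(M)}(\eta;\rho^{-1})$ for $\rho\ne0$; in particular $R_{-1}^{(M)}=0$. The regular Coulomb wave function is $F_L(\eta,\rho)=C_L(\eta)\rho^{L+1}\phi_L(\eta,\rho)$ with $$\phi_L(\eta,\rho)=e^{-i\rho}\,{}_1F_1(L+1-i\eta,2L+2,2i\rho),\qquad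 C_L(\eta)=\frac{2^Le^{-\pi\eta/2}\,|\Gamma(L+1+i\eta)|}{\Gamma(2L+2)},$$ where the same branch of $\log\rho$ is used in all powers of $\rho$. *)

theory Defs
  imports "HOL-Analysis.Analysis" "HOL-Computational_Algebra.Computational_Algebra"
begin

definition coulomb_w :: "real \<Rightarrow> real \<Rightarrow> real" where
  "coulomb_w \<eta> s = sqrt ((s + 1)\<^sup>2 + \<eta>\<^sup>2) / ((s + 1) * sqrt ((2 * s + 1) * (2 * s + 3)))"

definition coulomb_lambda :: "real \<Rightarrow> real \<Rightarrow> real" where
  "coulomb_lambda \<eta> s = - \<eta> / (s * (s + 1))"

text \<open>Shifted indexing, \<open>Q\<^sub>k = P\<^sub>k\<^sub>-\<^sub>1\<close>, so that the recursion can start from \<open>P\<^sub>-\<^sub>1 = 0\<close>.\<close>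

fun coulomb_Q :: "real \<Rightarrow> real \<Rightarrow> nat \<Rightarrow> complex poly" where
  "coulomb_Q M \<eta> 0 = 0"
| "coulomb_Q M \<eta> (Suc 0) = 1"
| "coulomb_Q M \<eta> (Suc (Suc k)) =
     smult (of_real (1 / coulomb_w \<eta> (M + real k + 1)))
       ([:- of_real (coulomb_lambda \<eta> (M + real k + 1)), 1:] * coulomb_Q M \<eta> (Suc k)
         - smult (of_real (coulomb_w \<eta> (M + real k))) (coulomb_Q M \<eta> k))"

text \<open>\<open>P\<^sub>n\<^sup>(\<^sup>M\<^sup>)(\<eta>; \<cdot>)\<close>; only the indices \<open>n \<ge> -1\<close> are meaningful.\<close>

definition coulomb_P :: "real \<Rightarrow> real \<Rightarrow> int \<Rightarrow> complex poly" where
  "coulomb_P M \<eta> n = coulomb_Q M \<eta> (nat (n + 1))"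

lemma coulomb_P_minus1 [simp]: "coulomb_P M \<eta> (-1) = 0"
  by (simp add: coulomb_P_def)

lemma coulomb_P_0 [simp]: "coulomb_P M \<eta> 0 = 1"
  by (simp add: coulomb_P_def)

lemma coulomb_w_nonzero:
  assumes "s > - 1 / 2"
  shows "coulomb_w \<eta> s \<noteq> 0"
proof -
  have "(s + 1)\<^sup>2 > 0" using assms by simp
  then have "(s + 1)\<^sup>2 + \<eta>\<^sup>2 > 0" by (simp add: add_pos_nonneg)
  moreover have "(2 * s + 1) * (2 * s + 3) > 0" using assms by simp
  ultimately show ?thesis using assms by (simp add: coulomb_w_def)
qed

text \<open>The defining three-term recurrence. For \<open>n = 0\<close> the first term on the right
  vanishes, whatever the value of \<open>coulomb_w \<eta> M\<close>.\<close>

lemma coulomb_P_recurrence: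
  assumes "M > - 3 / 2"
  shows "z * poly (coulomb_P M \<eta> (int n)) z =
      of_real (coulomb_w \<eta> (M + real n)) * poly (coulomb_P M \<eta> (int n - 1)) z
    + of_real (coulomb_lambda \<eta> (M + real n + 1)) * poly (coulomb_P M \<eta> (int n)) z
    + of_real (coulomb_w \<eta> (M + real n + 1)) * poly (coulomb_P M \<eta> (int n + 1)) z"
proof -
  have "coulomb_w \<eta> (M + real n + 1) \<noteq> 0"
    using assms by (intro coulomb_w_nonzero) linarith
  moreover have "nat (int n + 1) = Suc n" "nat (int n + 1 + 1) = Suc (Suc n)" by auto
  ultimately show ?thesis
    by (simp add: coulomb_P_def algebra_simps)
qed

definition coulomb_R :: "real \<Rightarrow> real \<Rightarrow> int \<Rightarrow> complex \<Rightarrow> complex" where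
  "coulomb_R M \<eta> n \<rho> = poly (coulomb_P M \<eta> n) (inverse \<rho>)"

definition hyp1F1 :: "complex \<Rightarrow> complex \<Rightarrow> complex \<Rightarrow> complex" where
  "hyp1F1 a b z = eval_fps (fps_hypergeo [a] [b] 1) z"

lemma hyp1F1_series:
  "hyp1F1 a b z = (\<Sum>k. pochhammer a k / (pochhammer b k * fact k) * z ^ k)"
  by (simp add: hyp1F1_def eval_fps_def fps_hypergeo_def)

definition coulomb_phi :: "real \<Rightarrow> real \<Rightarrow> complex \<Rightarrow> complex" where
  "coulomb_phi L \<eta> \<rho> =
     exp (- \<i> * \<rho>) * hyp1F1 (of_real L + 1 - \<i> * of_real \<eta>) (2 * of_real L + 2) (2 * \<i> * \<rho>)"

definition coulomb_C :: "real \<Rightarrow> real \<Rightarrow> real" where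
  "coulomb_C L \<eta> =
     2 powr L * exp (- pi * \<eta> / 2) * norm (Gamma (of_real L + 1 + \<i> * of_real \<eta> :: complex))
       / Gamma (2 * L + 2)"

text \<open>The power \<open>\<rho>\<^bsup>L+1\<^esup>\<close> depends on the branch of the logarithm, so the chosen value \<open>l\<close> of
  \<open>log \<rho>\<close> is an argument; it is to satisfy \<open>exp l = \<rho>\<close>.\<close>

definition coulomb_F :: "complex \<Rightarrow> real \<Rightarrow> real \<Rightarrow> complex \<Rightarrow> complex" where
  "coulomb_F l L \<eta> \<rho> =
     of_real (coulomb_C L \<eta>) * exp (of_real (L + 1) * l) * coulomb_phi L \<eta> \<rho>"

end

(* A contiguous relation for 1F1, linking the parameters (a, b), (a + 1, b + 2) and
   (a + 2, b + 4), is read off the power series coefficients. It turns into a three-term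
   recurrence in L for F_L, and after multiplication of F_L by sqrt (2 L + 1) this is
   the recurrence of the polynomials P_n. Hence both sides of the identity satisfy the
   same second-order recurrence in n, and they agree for n = 0 (trivially) and n = 1 (the
   recurrence of F_L at the index L itself). *)

theory Submission
  imports Defs "HOL-Real_Asymp.Real_Asymp"
begin

section \<open>Confluent hypergeometric series and a contiguous relation\<close>

definition hyp1F1_term :: "complex \<Rightarrow> complex \<Rightarrow> complex \<Rightarrow> nat \<Rightarrow> complex" where
  "hyp1F1_term a b z k = pochhammer a k / (pochhammer b k * fact k) * z ^ k"

text \<open>Ratio test: the quotient of consecutive terms is
  \<open>(a + k) * z / ((b + k) * (k + 1))\<close>, which tends to 0. This turns the value
  \<open>hyp1F1\<close>, defined by evaluating a formal series, into a genuine limit, so that series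
  can be added and shifted.\<close>

lemma hyp1F1_term_sums:
  assumes "b \<notin> \<int>\<^sub>\<le>\<^sub>0"
  shows "hyp1F1_term a b z sums hyp1F1 a b z"
proof -
  \<comment> \<open>By the triangle inequality this bounds the norm of the quotient of consecutive
    terms as soon as \<open>k > norm b\<close>.\<close>
  have lim: "(\<lambda>k. (norm a + real k) * norm z / ((real k - norm b) * (real k + 1))) \<longlonglongrightarrow> 0"
    by real_asymp
  have "eventually (\<lambda>k. (norm a + real k) * norm z / ((real k - norm b) * (real k + 1)) < 1 / 2) sequentially"
    by (rule order_tendstoD[OF lim]) simp
  moreover have "eventually (\<lambda>k. real k > norm b) sequentially"
    by real_asymp
  ultimately have "eventually (\<lambda>k. norm (hyp1F1_term a b z (Suc k)) \<le> 1 / 2 * norm (hyp1F1_term a b z k)) sequentially"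
  proof eventually_elim
    case (elim k)
    have "real k - norm b \<le> norm (b + of_nat k)"
      using norm_triangle_ineq2[of "of_nat k" "- b"] by (simp add: add.commute)
    moreover have "norm (a + of_nat k) \<le> norm a + real k"
      using norm_triangle_ineq[of a "of_nat k"] by simp
    moreover have "norm (of_nat k + 1 :: complex) = real k + 1"
      using norm_of_nat[of "Suc k", where 'a=complex] by (simp add: add.commute)
    ultimately have "norm ((a + of_nat k) * z / ((b + of_nat k) * (of_nat k + 1)))
        \<le> (norm a + real k) * norm z / ((real k - norm b) * (real k + 1))"
      unfolding norm_divide norm_mult using elim
      by (intro frac_le mult_mono mult_pos_pos) auto
    with elim have "norm ((a + of_nat k) * z / ((b + of_nat k) * (of_nat k + 1))) \<le> 1 / 2"
      by linarith
    moreover have "hyp1F1_term a b z (Suc k)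
        = (a + of_nat k) * z / ((b + of_nat k) * (of_nat k + 1)) * hyp1F1_term a b z k"
      by (simp add: hyp1F1_term_def pochhammer_Suc mult_ac add_ac)
    ultimately show ?case
      by (metis mult_right_mono norm_ge_zero norm_mult)
  qed
  then obtain N where "\<And>k. k \<ge> N \<Longrightarrow>
      norm (hyp1F1_term a b z (Suc k)) \<le> 1 / 2 * norm (hyp1F1_term a b z k)"
    by (auto simp: eventually_sequentially)
  then have "summable (hyp1F1_term a b z)"
    by (intro summable_ratio_test[of "1/2" N]) auto
  then show ?thesis
    by (simp add: summable_sums hyp1F1_series hyp1F1_term_def[abs_def])
qed

lemma pochhammer_plus_2:
  fixes b :: complex
  shows "pochhammer b (Suc (Suc k)) = b * (b + 1) * pochhammer (b + 2) k"
  by (simp add: pochhammer_rec add_ac)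

text \<open>Comparison of the coefficients of each power of \<open>z\<close>: the first two
  coefficients cancel, and from degree 2 on the three series contribute rational multiples of one
  common term. With \<open>a = L - \<i> * \<eta>\<close> and \<open>b = 2 * L\<close> the three
  functions are those in \<phi> at the indices \<open>L - 1\<close>, \<open>L\<close> and
  \<open>L + 1\<close>.\<close>

lemma hyp1F1_contiguous:
  assumes b: "b \<notin> \<int>\<^sub>\<le>\<^sub>0"
  shows "b * (b + 1) * (b + 2) * hyp1F1 a b z
    = (b + 1) * ((2 * a - b) * z + b * (b + 2)) * hyp1F1 (a + 1) (b + 2) z
      + b * (a + 1) * (b + 1 - a) / ((b + 2) * (b + 3)) * z\<^sup>2 * hyp1F1 (a + 2) (b + 4) z"
proof -
  have nz: "b + of_nat k \<noteq> 0" for k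
    using b plus_of_nat_eq_0_imp by blast
  have b2: "b + 2 \<notin> \<int>\<^sub>\<le>\<^sub>0" and b4: "b + 4 \<notin> \<int>\<^sub>\<le>\<^sub>0"
    using b nonpos_Ints_diff_Nats[of "b+2" 2] nonpos_Ints_diff_Nats[of "b+4" 4] by auto
  define D where "D = b * (a + 1) * (b + 1 - a) / ((b + 2) * (b + 3))"
  define f0 where "f0 = hyp1F1_term a b z"
  define f1 where "f1 = hyp1F1_term (a + 1) (b + 2) z"
  define f2 where "f2 = hyp1F1_term (a + 2) (b + 4) z"
  \<comment> \<open>\<open>g\<close> collects, by degree, the terms that carry no extra factor
    \<open>z\<close>. In \<open>h\<close> the term \<open>z * f1 k\<close> is subtracted as well; it
    has degree \<open>k + 1\<close>, hence the shifted index of \<open>g\<close>. So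
    \<open>h 0 = 0\<close> is the comparison in degree 1, and \<open>h (Suc k)\<close> belongs to
    degree \<open>k + 2\<close>.\<close>
  define g where "g k = b * (b + 1) * (b + 2) * f0 k - b * (b + 1) * (b + 2) * f1 k" for k
  define h where "h k = g (Suc k) - (b + 1) * (2 * a - b) * z * f1 k" for k
  note sums = hyp1F1_term_sums
  have g_sums: "g sums (b * (b + 1) * (b + 2) * hyp1F1 a b z - b * (b + 1) * (b + 2) * hyp1F1 (a + 1) (b + 2) z)"
    unfolding g_def f0_def f1_def by (intro sums_diff sums_mult sums b b2)
  have h0: "h 0 = 0"
    using nz[of 0] nz[of 2]
    by (simp add: h_def g_def f0_def f1_def hyp1F1_term_def divide_simps) algebra
  have hSuc: "h (Suc k) = D * z\<^sup>2 * f2 k" for k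
  proof -
    define u :: complex where "u = of_nat k"
    \<comment> \<open>The common term of degree \<open>k + 2\<close>: each of the four summands
      below is \<open>T\<close> times a rational function of \<open>a\<close>, \<open>b\<close> and
      \<open>u\<close>.\<close>
    define T where "T = pochhammer (a + 2) k / (pochhammer (b + 2) k * fact k) * z ^ (k + 2)"
    have nz': "b \<noteq> 0" "b + 1 \<noteq> 0" "b + 2 \<noteq> 0" "b + 3 \<noteq> 0" "b + (2 + u) \<noteq> 0" "b + (3 + u) \<noteq> 0"
      using nz[of 0] nz[of 1] nz[of 2] nz[of 3] nz[of "2 + k"] nz[of "3 + k"]
      by (simp_all add: u_def)
    have u: "u + 1 \<noteq> 0" "u + 2 \<noteq> 0"
      unfolding u_def by (metis of_nat_1 of_nat_add of_nat_eq_0_iff add_is_0 one_neq_zero,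
          metis of_nat_numeral of_nat_add of_nat_eq_0_iff add_is_0 zero_neq_numeral)
    have fact: "fact (k + 2) = (u + 2) * (u + 1) * fact k" "fact (k + 1) = (u + 1) * fact k"
      by (simp_all add: u_def algebra_simps)
    have b4_poch: "pochhammer (b + 4) k
        = pochhammer (b + 2) k * (b + (2 + u)) * (b + (3 + u)) / ((b + 2) * (b + 3))"
      using pochhammer_plus_2[of "b + 2" k] nz'
      by (simp add: eq_divide_eq pochhammer_Suc u_def add_ac mult_ac)
    have pa: "pochhammer (a + 1) (k + 2) = (a + 1) * pochhammer (a + 2) k * (a + (2 + u))"
      "pochhammer (a + 1) (k + 1) = (a + 1) * pochhammer (a + 2) k"
      using pochhammer_rec[of "a + 1" "Suc k"] pochhammer_rec[of "a + 1" k] pochhammer_Suc[of "a + 2" k]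
      by (simp_all add: u_def add_ac mult_ac)
    have pb: "pochhammer (b + 2) (k + 2) = pochhammer (b + 2) k * (b + (2 + u)) * (b + (3 + u))"
      "pochhammer (b + 2) (k + 1) = pochhammer (b + 2) k * (b + (2 + u))"
      by (simp_all add: pochhammer_Suc u_def add_ac)
    have 0: "f0 (k + 2) = a * (a + 1) / (b * (b + 1) * (u + 2) * (u + 1)) * T"
      unfolding f0_def hyp1F1_term_def fact T_def
      by (simp add: pochhammer_plus_2 mult_ac)
    have 1: "f1 (k + 2) = (a + 1) * (a + (2 + u)) / ((b + (2 + u)) * (b + (3 + u)) * (u + 2) * (u + 1)) * T"
      unfolding f1_def hyp1F1_term_def fact T_def
      by (simp only: pa(1) pb(1)) (simp add: mult_ac)
    have 2: "z * f1 (k + 1) = (a + 1) / ((b + (2 + u)) * (u + 1)) * T"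
      unfolding f1_def hyp1F1_term_def fact T_def
      by (simp only: pa(2) pb(2)) (simp add: mult_ac)
    have 3: "z\<^sup>2 * f2 k = (b + 2) * (b + 3) / ((b + (2 + u)) * (b + (3 + u))) * T"
      unfolding f2_def hyp1F1_term_def T_def b4_poch
      by (simp add: power2_eq_square mult_ac)
    have "h (Suc k) = b * (b + 1) * (b + 2) * (f0 (k + 2) - f1 (k + 2)) - (b + 1) * (2 * a - b) * (z * f1 (k + 1))"
      by (simp add: h_def g_def algebra_simps)
    also have "\<dots> = D * (z\<^sup>2 * f2 k)"
    proof -
      have factor: "p * (x * T - y * T) - q * (r * T) = (p * (x - y) - q * r) * T" for p q r x y
        by (simp add: algebra_simps)
      \<comment> \<open>With \<open>T\<close> factored out, only an identity between rational
        functions remains. The denominator of \<open>D\<close> is chosen to cancel the factors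
        \<open>(b + 2) * (b + 3)\<close> coming from the third series.\<close>
      have "b * (b + 1) * (b + 2) * (a * (a + 1) / (b * (b + 1) * (u + 2) * (u + 1))
            - (a + 1) * (a + (2 + u)) / ((b + (2 + u)) * (b + (3 + u)) * (u + 2) * (u + 1)))
          - (b + 1) * (2 * a - b) * ((a + 1) / ((b + (2 + u)) * (u + 1)))
          = b * (a + 1) * (b + 1 - a) / ((b + (2 + u)) * (b + (3 + u)))"
        using nz' u by (simp add: divide_simps) algebra
      also have "\<dots> = D * ((b + 2) * (b + 3) / ((b + (2 + u)) * (b + (3 + u))))"
        using nz' by (simp add: D_def)
      finally have coeff: "b * (b + 1) * (b + 2) * (a * (a + 1) / (b * (b + 1) * (u + 2) * (u + 1))
            - (a + 1) * (a + (2 + u)) / ((b + (2 + u)) * (b + (3 + u)) * (u + 2) * (u + 1)))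
          - (b + 1) * (2 * a - b) * ((a + 1) / ((b + (2 + u)) * (u + 1)))
          = D * ((b + 2) * (b + 3) / ((b + (2 + u)) * (b + (3 + u))))" .
      show ?thesis
        unfolding 0 1 2 3 factor coeff by (simp only: mult.assoc)
    qed
    finally show ?thesis by (simp add: mult.assoc)
  qed
  have "(\<lambda>k. h (Suc k)) sums (D * z\<^sup>2 * hyp1F1 (a + 2) (b + 4) z)"
    unfolding hSuc f2_def by (intro sums_mult sums b4)
  \<comment> \<open>The two shifts are now undone: first from \<open>h (Suc k)\<close> to
    \<open>h\<close>, then from \<open>g (Suc k)\<close> to \<open>g\<close>. The prepended terms
    vanish, the latter because both series start with 1.\<close>
  from sums_Suc[OF this] have "h sums (D * z\<^sup>2 * hyp1F1 (a + 2) (b + 4) z)"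
    by (simp add: h0)
  from sums_add[OF this sums_mult[OF sums[OF b2, of "a + 1" z], of "(b + 1) * (2 * a - b) * z"]]
  have "(\<lambda>k. g (Suc k)) sums (D * z\<^sup>2 * hyp1F1 (a + 2) (b + 4) z
      + (b + 1) * (2 * a - b) * z * hyp1F1 (a + 1) (b + 2) z)"
    by (simp add: h_def f1_def)
  moreover have "g 0 = 0"
    by (simp add: g_def f0_def f1_def hyp1F1_term_def)
  ultimately have "g sums (D * z\<^sup>2 * hyp1F1 (a + 2) (b + 4) z
      + (b + 1) * (2 * a - b) * z * hyp1F1 (a + 1) (b + 2) z)"
    using sums_Suc by fastforce
  from sums_unique2[OF g_sums this] show ?thesis
    by (simp add: D_def algebra_simps)
qed

section \<open>Three-term recurrence in L for the Coulomb wave functions\<close>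

text \<open>The only nonpositive integer above -1 is 0. For \<open>K > - 1 / 2\<close> and
  \<open>K \<noteq> 0\<close> this keeps \<open>2 * K\<close> away from the poles of Gamma and makes
  it an admissible lower parameter of 1F1.\<close>

lemma not_nonpos_Int_real:
  fixes x :: real
  assumes "x \<noteq> 0" "x > -1"
  shows "x \<notin> \<int>\<^sub>\<le>\<^sub>0"
proof
  assume "x \<in> \<int>\<^sub>\<le>\<^sub>0"
  then obtain m where "x = of_int m" "m \<le> 0"
    by (auto elim: nonpos_Ints_cases)
  with assms show False by (cases "m \<le> -1") auto
qed

text \<open>The contiguous relation at \<open>a = K - \<i> * \<eta>\<close>,
  \<open>b = 2 * K\<close> and \<open>z = 2 * \<i> * \<rho>\<close>, multiplied by the exponential
  factor that the three functions share.\<close>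

lemma coulomb_phi_recurrence:
  assumes "K \<noteq> 0" "K > - 1 / 2"
  shows "of_real (2 * K + 1) * (of_real (K * (K + 1)) + of_real \<eta> * \<rho>) * coulomb_phi K \<eta> \<rho>
    = of_real (K * (K + 1) * (2 * K + 1)) * coulomb_phi (K - 1) \<eta> \<rho>
      + of_real (K * ((K + 1)\<^sup>2 + \<eta>\<^sup>2) / ((K + 1) * (2 * K + 3))) * \<rho>\<^sup>2 * coulomb_phi (K + 1) \<eta> \<rho>"
proof -
  define k where "k = complex_of_real K"
  define e where "e = complex_of_real \<eta>"
  define a where "a = k - \<i> * e"
  have nz: "k + 1 \<noteq> 0" "2 * k + 2 \<noteq> 0" "2 * k + 3 \<noteq> 0"
    using assms by (simp_all add: k_def complex_eq_iff)
  have "2 * K \<notin> \<int>\<^sub>\<le>\<^sub>0"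
    using assms by (intro not_nonpos_Int_real) auto
  then have "2 * k \<notin> \<int>\<^sub>\<le>\<^sub>0"
    using of_real_in_nonpos_Ints_iff[of "2 * K", where 'a=complex] by (simp add: k_def)
  define M0 M1 M2 where "M0 = hyp1F1 a (2 * k) (2 * \<i> * \<rho>)"
    and "M1 = hyp1F1 (a + 1) (2 * k + 2) (2 * \<i> * \<rho>)"
    and "M2 = hyp1F1 (a + 2) (2 * k + 4) (2 * \<i> * \<rho>)"
  have contig: "2 * k * (2 * k + 1) * (2 * k + 2) * M0
      = (2 * k + 1) * ((2 * a - 2 * k) * (2 * \<i> * \<rho>) + 2 * k * (2 * k + 2)) * M1
        + 2 * k * (a + 1) * (2 * k + 1 - a) / ((2 * k + 2) * (2 * k + 3)) * (2 * \<i> * \<rho>)\<^sup>2 * M2"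
    unfolding M0_def M1_def M2_def by (rule hyp1F1_contiguous) fact
  have i: "(2 * a - 2 * k) * (2 * \<i> * \<rho>) = 4 * e * \<rho>"
    by (simp add: a_def algebra_simps)
  \<comment> \<open>The two factors on the left are \<open>k + 1 - \<i> * e\<close> and
    \<open>k + 1 + \<i> * e\<close>.\<close>
  have ii: "(a + 1) * (2 * k + 1 - a) = (k + 1)\<^sup>2 + e\<^sup>2"
    by (simp add: a_def algebra_simps power2_eq_square)
  have iii: "(2 * \<i> * \<rho>)\<^sup>2 = - 4 * \<rho>\<^sup>2"
    by (simp add: power_mult_distrib)
  \<comment> \<open>Cancels the overall factor 4 and moves the last term, negative because of
    \<open>iii\<close>, to the other side.\<close>
  have aux: "y = x + w" if "4 * x = 4 * y + - 4 * w" for x y w :: complex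
  proof -
    from that have "4 * y = 4 * (x + w)" by simp
    then show ?thesis by (simp only: mult_cancel_left) simp
  qed
  have "4 * (k * (k + 1) * (2 * k + 1) * M0)
      = 4 * ((2 * k + 1) * (k * (k + 1) + e * \<rho>) * M1)
        + 2 * k * ((a + 1) * (2 * k + 1 - a)) / ((2 * k + 2) * (2 * k + 3)) * (2 * \<i> * \<rho>)\<^sup>2 * M2"
    using contig unfolding i by (simp add: algebra_simps)
  also have "2 * k * ((a + 1) * (2 * k + 1 - a)) / ((2 * k + 2) * (2 * k + 3)) * (2 * \<i> * \<rho>)\<^sup>2 * M2
      = - 4 * (k * ((k + 1)\<^sup>2 + e\<^sup>2) / ((k + 1) * (2 * k + 3)) * \<rho>\<^sup>2 * M2)"
    unfolding ii iii using nz by (simp add: divide_simps)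
  finally have *: "(2 * k + 1) * (k * (k + 1) + e * \<rho>) * M1
      = k * (k + 1) * (2 * k + 1) * M0 + k * ((k + 1)\<^sup>2 + e\<^sup>2) / ((k + 1) * (2 * k + 3)) * \<rho>\<^sup>2 * M2"
    by (rule aux)
  have phi: "coulomb_phi (K - 1) \<eta> \<rho> = exp (- \<i> * \<rho>) * M0" "coulomb_phi K \<eta> \<rho> = exp (- \<i> * \<rho>) * M1"
    "coulomb_phi (K + 1) \<eta> \<rho> = exp (- \<i> * \<rho>) * M2"
    by (simp_all add: coulomb_phi_def M0_def M1_def M2_def a_def k_def e_def algebra_simps)
  show ?thesis
    unfolding phi using arg_cong[OF *, of "\<lambda>x. exp (- \<i> * \<rho>) * x"]
    by (simp add: k_def[symmetric] e_def[symmetric] distrib_left mult_ac)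
qed

text \<open>The functional equation of Gamma, used once at \<open>K + \<i> * \<eta>\<close> in the
  numerator and twice in the denominator, from \<open>2 * K\<close> to \<open>2 * K + 2\<close>. For
  negative \<open>K\<close> both \<open>K\<close> and \<open>Gamma (2 * K)\<close> are negative, so
  the factor contains \<open>K\<close> and not its absolute value.\<close>

lemma coulomb_C_rec:
  assumes "K \<noteq> 0" "K > - 1 / 2"
  shows "coulomb_C K \<eta> = sqrt (K\<^sup>2 + \<eta>\<^sup>2) / (K * (2 * K + 1)) * coulomb_C (K - 1) \<eta>"
proof -
  have *: "2 * K \<notin> \<int>\<^sub>\<le>\<^sub>0" "2 * K + 1 \<notin> \<int>\<^sub>\<le>\<^sub>0" "K \<notin> \<int>\<^sub>\<le>\<^sub>0"
    using assms by (intro not_nonpos_Int_real; linarith)+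
  have "of_real K + \<i> * of_real \<eta> \<notin> (\<int>\<^sub>\<le>\<^sub>0 :: complex set)"
  proof
    assume "of_real K + \<i> * of_real \<eta> \<in> (\<int>\<^sub>\<le>\<^sub>0 :: complex set)"
    then obtain m where "of_real K + \<i> * of_real \<eta> = (of_int m :: complex)" "m \<le> 0"
      by (auto elim: nonpos_Ints_cases)
    then have "K = of_int m" by (simp add: complex_eq_iff)
    with * \<open>m \<le> 0\<close> show False by (simp add: nonpos_Ints_of_int)
  qed
  from Gamma_plus1[OF this] have "Gamma (of_real K + 1 + \<i> * of_real \<eta> :: complex)
      = (of_real K + \<i> * of_real \<eta>) * Gamma (of_real K + \<i> * of_real \<eta>)"
    by (simp add: add_ac)
  then have 1: "norm (Gamma (of_real K + 1 + \<i> * of_real \<eta> :: complex))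
      = sqrt (K\<^sup>2 + \<eta>\<^sup>2) * norm (Gamma (of_real K + \<i> * of_real \<eta> :: complex))"
    using complex_norm[of K \<eta>] by (simp add: norm_mult Complex_eq)
  define d where "d = 2 * K + 1"
  have 2: "Gamma (2 * K + 2) = 2 * (K * d * Gamma (2 * K))"
    using Gamma_plus1[OF *(1)] Gamma_plus1[OF *(2)] by (simp add: d_def add_ac)
  have 3: "2 powr K = 2 * 2 powr (K - 1)"
    by (simp add: powr_diff)
  show ?thesis
    unfolding coulomb_C_def 1 2 3 d_def[symmetric] by (simp add: mult_ac)
qed

text \<open>The recurrence of \<phi> times \<open>C_K\<close> and the \<open>K\<close>-th power of
  \<rho>; \<open>coulomb_C_rec\<close> expresses the two neighbouring constants by
  \<open>C_K\<close>.\<close>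

lemma coulomb_F_recurrence:
  assumes "K \<noteq> 0" "K > - 1 / 2" "exp l = \<rho>"
  shows "of_real (sqrt (K\<^sup>2 + \<eta>\<^sup>2) / K) * coulomb_F l (K - 1) \<eta> \<rho>
      + of_real (sqrt ((K + 1)\<^sup>2 + \<eta>\<^sup>2) / (K + 1)) * coulomb_F l (K + 1) \<eta> \<rho>
    = of_real (2 * K + 1) * (inverse \<rho> + of_real (\<eta> / (K * (K + 1)))) * coulomb_F l K \<eta> \<rho>"
proof -
  define s where "s = sqrt (K\<^sup>2 + \<eta>\<^sup>2)"
  define t where "t = sqrt ((K + 1)\<^sup>2 + \<eta>\<^sup>2)"
  define c where "c = coulomb_C K \<eta>"
  define E where "E = exp (of_real K * l)"
  have nz: "K + 1 \<noteq> 0" "2 * K + 1 \<noteq> 0" "2 * K + 3 \<noteq> 0" "\<rho> \<noteq> 0"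
    using assms by auto
  have t2: "t\<^sup>2 = (K + 1)\<^sup>2 + \<eta>\<^sup>2"
    by (simp add: t_def)
  have "s / K * coulomb_C (K - 1) \<eta> = (2 * K + 1) * c"
  proof -
    have "s / K * x = d * (s / (K * d) * x)" if "d \<noteq> 0" for d x
      using that by simp
    from this[OF nz(2)] show ?thesis
      by (simp only: c_def s_def coulomb_C_rec[OF assms(1,2), of \<eta>])
  qed
  then have C0: "of_real (s / K) * of_real (coulomb_C (K - 1) \<eta>) = (of_real (2 * K + 1) * of_real c :: complex)"
    by (metis of_real_mult)
  \<comment> \<open>The root \<open>t\<close> in this constant meets the \<open>t\<close> in the
    coefficient of the recurrence, which gives the polynomial \<open>t\<^sup>2\<close> that occurs
    in the recurrence of \<phi>.\<close>
  have "coulomb_C (K + 1) \<eta> = t / ((K + 1) * (2 * K + 3)) * c"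
    using coulomb_C_rec[of "K + 1" \<eta>] assms(2) by (simp add: c_def t_def add_ac distrib_left)
  then have "K * (K + 1) * (t / (K + 1) * coulomb_C (K + 1) \<eta>) = K * ((K + 1)\<^sup>2 + \<eta>\<^sup>2) / ((K + 1) * (2 * K + 3)) * c"
    using nz unfolding t2[symmetric] by (simp add: power2_eq_square)
  then have C1: "of_real (K * (K + 1)) * (of_real (t / (K + 1)) * of_real (coulomb_C (K + 1) \<eta>))
      = (of_real (K * ((K + 1)\<^sup>2 + \<eta>\<^sup>2) / ((K + 1) * (2 * K + 3))) * of_real c :: complex)"
    by (metis of_real_mult)
  \<comment> \<open>Here the common branch enters: all three powers come from the same
    \<open>l\<close>, so they differ exactly by factors \<rho>.\<close>
  have powers: "exp (of_real (K - 1 + 1) * l) = E" "exp (of_real (K + 1) * l) = E * \<rho>"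
    "exp (of_real (K + 1 + 1) * l) = E * \<rho>\<^sup>2"
    using assms(3) by (simp_all add: E_def distrib_right exp_add exp_double)
  have F: "coulomb_F l (K - 1) \<eta> \<rho> = of_real (coulomb_C (K - 1) \<eta>) * E * coulomb_phi (K - 1) \<eta> \<rho>"
    "coulomb_F l K \<eta> \<rho> = of_real c * (E * \<rho>) * coulomb_phi K \<eta> \<rho>"
    "coulomb_F l (K + 1) \<eta> \<rho> = of_real (coulomb_C (K + 1) \<eta>) * (E * \<rho>\<^sup>2) * coulomb_phi (K + 1) \<eta> \<rho>"
    unfolding coulomb_F_def c_def powers by (rule refl)+
  \<comment> \<open>The factor \<open>K * (K + 1)\<close> produces the coefficients of
    \<open>coulomb_phi_recurrence\<close>; being nonzero, it is cancelled at the end.\<close>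
  have "of_real (K * (K + 1)) * (of_real (s / K) * coulomb_F l (K - 1) \<eta> \<rho>
        + of_real (t / (K + 1)) * coulomb_F l (K + 1) \<eta> \<rho>)
      = of_real (K * (K + 1)) * (of_real (s / K) * of_real (coulomb_C (K - 1) \<eta>)) * E * coulomb_phi (K - 1) \<eta> \<rho>
        + of_real (K * (K + 1)) * (of_real (t / (K + 1)) * of_real (coulomb_C (K + 1) \<eta>)) * (E * \<rho>\<^sup>2) * coulomb_phi (K + 1) \<eta> \<rho>"
    unfolding F by (simp only: distrib_left mult_ac)
  also have "\<dots> = of_real c * E *
      (of_real (K * (K + 1) * (2 * K + 1)) * coulomb_phi (K - 1) \<eta> \<rho>
      + of_real (K * ((K + 1)\<^sup>2 + \<eta>\<^sup>2) / ((K + 1) * (2 * K + 3))) * \<rho>\<^sup>2 * coulomb_phi (K + 1) \<eta> \<rho>)"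
    unfolding C0 C1 of_real_mult[of "K * (K + 1)" "2 * K + 1"] by (simp only: distrib_left mult_ac)
  also have "\<dots> = of_real c * E * (of_real (2 * K + 1) * (of_real (K * (K + 1)) + of_real \<eta> * \<rho>) * coulomb_phi K \<eta> \<rho>)"
    by (simp only: coulomb_phi_recurrence[OF assms(1,2)])
  \<comment> \<open>One \<rho> is split off, because \<open>F_K\<close> contains
    \<open>E * \<rho>\<close> and not just \<open>E\<close>.\<close>
  also have "of_real (K * (K + 1)) + of_real \<eta> * \<rho>
      = of_real (K * (K + 1)) * (inverse \<rho> + of_real (\<eta> / (K * (K + 1)))) * \<rho>"
  proof -
    have "p + e * \<rho> = p * (inverse \<rho> + e / p) * \<rho>" if "p \<noteq> 0" for p e :: complex
      using that nz(4) by (simp add: field_simps)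
    moreover have "complex_of_real (K * (K + 1)) \<noteq> 0"
      using nz assms(1) by (simp only: of_real_eq_0_iff mult_eq_0_iff) simp
    ultimately show ?thesis
      unfolding of_real_divide by blast
  qed
  finally have "of_real (K * (K + 1)) * (of_real (s / K) * coulomb_F l (K - 1) \<eta> \<rho>
        + of_real (t / (K + 1)) * coulomb_F l (K + 1) \<eta> \<rho>)
      = of_real (K * (K + 1)) * (of_real (2 * K + 1) * (inverse \<rho> + of_real (\<eta> / (K * (K + 1)))) * coulomb_F l K \<eta> \<rho>)"
    unfolding F by (simp only: mult_ac)
  moreover have "complex_of_real (K * (K + 1)) \<noteq> 0"
    using nz assms(1) by (simp flip: of_real_add of_real_mult)
  ultimately show ?thesis
    unfolding s_def t_def by simp
qed

section \<open>Normalization to the recurrence of the polynomials\<close>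

lemma coulomb_w_mult_sqrt:
  assumes "K > - 1 / 2"
  shows "coulomb_w \<eta> K * sqrt (2 * K + 3) = sqrt ((K + 1)\<^sup>2 + \<eta>\<^sup>2) / (K + 1) / sqrt (2 * K + 1)"
    and "coulomb_w \<eta> K * sqrt (2 * K + 1) = sqrt ((K + 1)\<^sup>2 + \<eta>\<^sup>2) / (K + 1) / sqrt (2 * K + 3)"
  using assms by (simp_all add: coulomb_w_def real_sqrt_mult)

text \<open>The factor \<open>sqrt (2 * K + 1)\<close> makes the recurrence symmetric: the coupling
  between \<open>K\<close> and \<open>K + 1\<close> becomes \<open>coulomb_w \<eta> K\<close> in
  both equations where it occurs. The bound \<open>K > 1 / 2\<close> keeps the radicand at the lower
  index \<open>K - 1\<close> positive.\<close>

lemma normalized_coulomb_F_recurrence: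
  fixes \<eta> :: real and l \<rho> :: complex
  defines "g K \<equiv> of_real (sqrt (2 * K + 1)) * coulomb_F l K \<eta> \<rho>"
  assumes "K > 1 / 2" "exp l = \<rho>"
  shows "inverse \<rho> * g K = of_real (coulomb_w \<eta> (K - 1)) * g (K - 1)
    + of_real (coulomb_lambda \<eta> K) * g K + of_real (coulomb_w \<eta> K) * g (K + 1)"
proof -
  define q where "q = complex_of_real (sqrt (2 * K + 1))"
  have q: "q \<noteq> 0" "q * q = of_real (2 * K + 1)"
    using assms by (simp_all add: q_def flip: of_real_mult)
  have "coulomb_w \<eta> (K - 1) * sqrt (2 * (K - 1) + 1) = sqrt (K\<^sup>2 + \<eta>\<^sup>2) / K / sqrt (2 * K + 1)"
    using coulomb_w_mult_sqrt(2)[of "K - 1" \<eta>] assms(2) by simp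
  then have w0: "of_real (coulomb_w \<eta> (K - 1)) * of_real (sqrt (2 * (K - 1) + 1)) = of_real (sqrt (K\<^sup>2 + \<eta>\<^sup>2) / K) / q"
    unfolding q_def by (metis of_real_mult of_real_divide)
  have "coulomb_w \<eta> K * sqrt (2 * (K + 1) + 1) = sqrt ((K + 1)\<^sup>2 + \<eta>\<^sup>2) / (K + 1) / sqrt (2 * K + 1)"
    using coulomb_w_mult_sqrt(1)[of K \<eta>] assms(2) by (simp add: add_ac)
  then have w1: "of_real (coulomb_w \<eta> K) * of_real (sqrt (2 * (K + 1) + 1)) = of_real (sqrt ((K + 1)\<^sup>2 + \<eta>\<^sup>2) / (K + 1)) / q"
    unfolding q_def by (metis of_real_mult of_real_divide)
  have "of_real (coulomb_w \<eta> (K - 1)) * g (K - 1) + of_real (coulomb_w \<eta> K) * g (K + 1)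
    = (of_real (sqrt (K\<^sup>2 + \<eta>\<^sup>2) / K) * coulomb_F l (K - 1) \<eta> \<rho>
      + of_real (sqrt ((K + 1)\<^sup>2 + \<eta>\<^sup>2) / (K + 1)) * coulomb_F l (K + 1) \<eta> \<rho>) / q"
    unfolding g_def mult.assoc[symmetric] w0 w1 by (simp add: add_divide_distrib)
  \<comment> \<open>The factor \<open>2 * K + 1\<close> of \<open>coulomb_F_recurrence\<close> is
    \<open>q * q\<close>; dividing by \<open>q\<close> leaves the one \<open>q\<close> that turns
    \<open>F_K\<close> into \<open>g K\<close>.\<close>
  also have "\<dots> = (q * q) * (inverse \<rho> + of_real (\<eta> / (K * (K + 1)))) * coulomb_F l K \<eta> \<rho> / q"
    using coulomb_F_recurrence[of K l \<rho> \<eta>] assms(2,3) unfolding q(2) by simp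
  also have "\<dots> = (inverse \<rho> - of_real (coulomb_lambda \<eta> K)) * g K"
    using q(1) by (simp add: g_def q_def coulomb_lambda_def)
  finally show ?thesis by (simp add: algebra_simps)
qed

lemma coulomb_R_recurrence:
  assumes "M > - 3 / 2"
  shows "inverse \<rho> * coulomb_R M \<eta> (int n) \<rho>
    = of_real (coulomb_w \<eta> (M + real n)) * coulomb_R M \<eta> (int n - 1) \<rho>
      + of_real (coulomb_lambda \<eta> (M + real n + 1)) * coulomb_R M \<eta> (int n) \<rho>
      + of_real (coulomb_w \<eta> (M + real n + 1)) * coulomb_R M \<eta> (int n + 1) \<rho>"
  unfolding coulomb_R_def by (rule coulomb_P_recurrence[OF assms])

section \<open>The identity by induction on n\<close>

theorem mainTheorem7:
  fixes n :: nat and L \<eta> :: real and \<rho> l :: complex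
  assumes "L \<noteq> 0" and "L > - 1 / 2" and "\<rho> \<noteq> 0"
    and log_branch: "exp l = \<rho>"
  shows "coulomb_R (L - 1) \<eta> (int n) \<rho> * coulomb_F l L \<eta> \<rho>
      - of_real ((L + 1) / L * sqrt ((2 * L + 3) / (2 * L + 1))
          * (sqrt (\<eta>\<^sup>2 + L\<^sup>2) / sqrt (\<eta>\<^sup>2 + (L + 1)\<^sup>2)))
        * coulomb_R L \<eta> (int n - 1) \<rho> * coulomb_F l (L - 1) \<eta> \<rho>
    = of_real (sqrt ((2 * L + 2 * real n + 1) / (2 * L + 1))) * coulomb_F l (L + real n) \<eta> \<rho>"
proof -
  define A where "A = (L + 1) / L * sqrt ((2 * L + 3) / (2 * L + 1)) * (sqrt (\<eta>\<^sup>2 + L\<^sup>2) / sqrt (\<eta>\<^sup>2 + (L + 1)\<^sup>2))"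
  define X where "X n = coulomb_R (L - 1) \<eta> (int n) \<rho> * coulomb_F l L \<eta> \<rho>
      - of_real A * coulomb_R L \<eta> (int n - 1) \<rho> * coulomb_F l (L - 1) \<eta> \<rho>" for n
  define G where "G n = of_real (sqrt ((2 * L + 2 * real n + 1) / (2 * L + 1))) * coulomb_F l (L + real n) \<eta> \<rho>" for n
  \<comment> \<open>Since \<open>(L - 1) + (m + 1) = L + m\<close>, the polynomials with parameter
    \<open>L - 1\<close> at \<open>m + 1\<close> and those with parameter \<open>L\<close> at
    \<open>m\<close> have the same recurrence coefficients. The factors \<open>F_L\<close>,
    \<open>F_(L-1)\<close> and \<open>A\<close> do not depend on the index, so the combination obeys
    the recurrence too.\<close>
  have recX: "inverse \<rho> * X (Suc m) = of_real (coulomb_w \<eta> (L + real m)) * X m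
      + of_real (coulomb_lambda \<eta> (L + real m + 1)) * X (Suc m)
      + of_real (coulomb_w \<eta> (L + real m + 1)) * X (Suc (Suc m))" for m
  proof -
    have 1: "inverse \<rho> * coulomb_R (L - 1) \<eta> (int (Suc m)) \<rho>
      = of_real (coulomb_w \<eta> (L + real m)) * coulomb_R (L - 1) \<eta> (int m) \<rho>
        + of_real (coulomb_lambda \<eta> (L + real m + 1)) * coulomb_R (L - 1) \<eta> (int (Suc m)) \<rho>
        + of_real (coulomb_w \<eta> (L + real m + 1)) * coulomb_R (L - 1) \<eta> (int (Suc (Suc m))) \<rho>"
      using coulomb_R_recurrence[of "L - 1" \<rho> \<eta> "Suc m"] assms(2) by (simp add: algebra_simps)
    have 2: "inverse \<rho> * coulomb_R L \<eta> (int (Suc m) - 1) \<rho>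
      = of_real (coulomb_w \<eta> (L + real m)) * coulomb_R L \<eta> (int m - 1) \<rho>
        + of_real (coulomb_lambda \<eta> (L + real m + 1)) * coulomb_R L \<eta> (int (Suc m) - 1) \<rho>
        + of_real (coulomb_w \<eta> (L + real m + 1)) * coulomb_R L \<eta> (int (Suc (Suc m)) - 1) \<rho>"
      using coulomb_R_recurrence[of L \<rho> \<eta> m] assms(2) by (simp add: algebra_simps)
    have "inverse \<rho> * X (Suc m)
      = (inverse \<rho> * coulomb_R (L - 1) \<eta> (int (Suc m)) \<rho>) * coulomb_F l L \<eta> \<rho>
        - of_real A * (inverse \<rho> * coulomb_R L \<eta> (int (Suc m) - 1) \<rho>) * coulomb_F l (L - 1) \<eta> \<rho>"
      unfolding X_def by (simp only: right_diff_distrib mult_ac)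
    then show ?thesis
      unfolding 1 2 unfolding X_def by (simp only: algebra_simps)
  qed
  have G: "G n = of_real (1 / sqrt (2 * L + 1)) * (of_real (sqrt (2 * (L + real n) + 1)) * coulomb_F l (L + real n) \<eta> \<rho>)" for n
    using assms(2) by (simp add: G_def real_sqrt_divide distrib_left)
  have recG: "inverse \<rho> * G (Suc m) = of_real (coulomb_w \<eta> (L + real m)) * G m
      + of_real (coulomb_lambda \<eta> (L + real m + 1)) * G (Suc m)
      + of_real (coulomb_w \<eta> (L + real m + 1)) * G (Suc (Suc m))" for m
  proof -
    have K: "L + real m + 1 > 1 / 2"
      using assms(2) by simp
    have idx: "L + real m + 1 - 1 = L + real m" "L + real (Suc m) = L + real m + 1"
      "L + real (Suc (Suc m)) = L + real m + 1 + 1" by simp_all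
    show ?thesis
      unfolding G idx
      using arg_cong[OF normalized_coulomb_F_recurrence[OF K log_branch, of \<eta>],
          of "\<lambda>x. complex_of_real (1 / sqrt (2 * L + 1)) * x"]
      unfolding idx by (simp only: distrib_left mult_ac)
  qed
  have w: "complex_of_real (coulomb_w \<eta> (L + real m)) \<noteq> 0" for m
    using coulomb_w_nonzero[of "L + real m" \<eta>] assms(2) by simp
  have "X n = G n"
  proof (induction n rule: induct_nat_012)
    case 0
    show ?case using assms(2) by (simp add: X_def G_def coulomb_R_def)
  next
    \<comment> \<open>The normalized recurrence is available only above \<open>1 / 2\<close>, while
      \<open>L\<close> may be smaller. So the unnormalized \<open>coulomb_F_recurrence\<close> at
      \<open>L\<close> is used, divided by \<open>2 * L + 1\<close>; after multiplication by
      \<open>coulomb_w \<eta> L\<close>, the facts \<open>R1\<close>, \<open>WA\<close> and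
      \<open>WG\<close> match its coefficients with those of the claim. This is where the value of
      \<open>A\<close> matters.\<close>
    case 1
    define t where "t = sqrt ((L + 1)\<^sup>2 + \<eta>\<^sup>2)"
    define s where "s = sqrt (L\<^sup>2 + \<eta>\<^sup>2)"
    define p where "p = sqrt (2 * L + 1)"
    define q where "q = sqrt (2 * L + 3)"
    have pq: "p > 0" "q > 0" "p * p = 2 * L + 1"
      using assms(2) by (simp_all add: p_def q_def)
    have "t > 0"
      using assms(2) by (simp add: t_def add_pos_nonneg)
    have W: "coulomb_w \<eta> L = t / ((L + 1) * (p * q))"
      by (simp add: coulomb_w_def t_def p_def q_def real_sqrt_mult)
    have WA: "coulomb_w \<eta> L * A = s / L / (2 * L + 1)"
    proof -
      have "A = (L + 1) / L * (q / p) * (s / t)"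
        by (simp add: A_def real_sqrt_divide s_def t_def p_def q_def add.commute)
      then show ?thesis
        unfolding W pq(3)[symmetric] using pq \<open>t > 0\<close> assms(2) by simp
    qed
    have WG: "coulomb_w \<eta> L * sqrt ((2 * L + 3) / (2 * L + 1)) = t / (L + 1) / (2 * L + 1)"
      unfolding W pq(3)[symmetric] using pq assms(2)
      by (simp add: real_sqrt_divide flip: q_def) (simp add: p_def)
    have R1: "of_real (coulomb_w \<eta> L) * coulomb_R (L - 1) \<eta> 1 \<rho> = inverse \<rho> + of_real (\<eta> / (L * (L + 1)))"
      using coulomb_R_recurrence[of "L - 1" \<rho> \<eta> 0] assms(2)
      by (simp add: coulomb_R_def coulomb_lambda_def algebra_simps)
    have nz: "complex_of_real (2 * L + 1) \<noteq> 0"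
      using assms(2) by (simp only: of_real_eq_0_iff)
    have "of_real (coulomb_w \<eta> L) * X (Suc 0)
      = (of_real (coulomb_w \<eta> L) * coulomb_R (L - 1) \<eta> 1 \<rho>) * coulomb_F l L \<eta> \<rho>
        - of_real (coulomb_w \<eta> L * A) * coulomb_F l (L - 1) \<eta> \<rho>"
      by (simp add: X_def coulomb_R_def algebra_simps)
    also have "\<dots> = of_real (t / (L + 1)) / of_real (2 * L + 1) * coulomb_F l (L + 1) \<eta> \<rho>"
    proof -
      have "x * v - a / q * u = b / q * y" if "a * u + b * y = q * x * v" "q \<noteq> 0" for a b q u v x y :: complex
        using that by (simp add: field_simps)
      from this[OF coulomb_F_recurrence[OF assms(1,2) log_branch, of \<eta>] nz] show ?thesis
        unfolding R1 WA of_real_divide[of _ "2 * L + 1"] s_def t_def .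
    qed
    also have "\<dots> = of_real (coulomb_w \<eta> L) * G (Suc 0)"
      unfolding of_real_divide[symmetric] WG[symmetric] by (simp add: G_def add_ac)
    finally show ?case using w[of 0] by simp
  next
    case (ge2 m)
    \<comment> \<open>By the induction hypotheses the two recurrences agree in every term but the
      last, whose coefficient is nonzero by \<open>w\<close>.\<close>
    have "of_real (coulomb_w \<eta> (L + real m + 1)) * X (Suc (Suc m))
        = of_real (coulomb_w \<eta> (L + real m + 1)) * G (Suc (Suc m))"
      using recX[of m, unfolded ge2] recG[of m] by (metis add_left_cancel)
    then show ?case using w[of "Suc m"] by (simp add: add_ac)
  qed
  then show ?thesis
    by (simp only: X_def G_def A_def)
qed

end
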